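(* Let $G$ be a self-similar group generated by (the states of) a finite invertible automaton over the $2$-letter alphabet $X=\{0,1\}$, and let $g\in G$. Let $k=|\{g_v : v\in X^*\}|$ be the (finite) number of distinct sections of $g$, let $c_i$ be the number of vertices $v\in X^i$ such that $g_v$ acts nontrivially on the first level, and let $\bar g=\sum_{i\ge 0}(c_i \bmod 2)\,t^i\in C_2[[t]]$. Then: 1. $g$ acts level transitively on $X^*$ if and only if $c_i\equiv 1 \pmod 2$ for all $i\ge 0$. 2. If $g=\sigma^i(g_0,g_1)$ with $i\in\{0,1\}$, then $\bar g=i+t(\overline{g_0}+\overline{g_1})$. 3. $\bar g$ is a rational function $P(t)/Q(t)$ with $P,Q$ polynomials over $C_2$ of degree at most $k$, and the sequence $(c_i\bmod 2)_{i\ge0}$ is preperiodic with period and preperiod at most $2^k$. 4. $g$ acts level transitively on $X^*$ if and only if $c_i\equiv 1\pmod 2$ for all $i=0,1,\dots,2^{k+1}$.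
   Context: $X^*$ is the set of finite words over $X=\{0,1\}$, viewed as the rooted binary tree with levels $X^n$; $\sigma=(01)\in\mathrm{Sym}(X)$. Every $g\in\mathrm{Aut}(X^* )$ can be written uniquely as $g=\sigma^i(g_0,g_1)$, $i\in\{0,1\}$, $g_0,g_1\in \mathrm{Aut}(X^* )$, meaning $g(xw)=\sigma^i(x)g_x(w)$ for $x\in X$, $w\in X^*$. The section $g_v$ of $g$ at $v\in X^*$ is defined by $g(vw)=g(v)g_v(w)$ for all $w\in X^*$. A finite invertible automaton over $X$ is a finite set $Q$ of states with relations $q=\sigma^{i_q}(q_0,q_1)$, $i_q\in\{0,1\}$, $q_0,q_1\in Q$; each state thereby defines an element of $\mathrm{Aut}(X^* )$, and the group generated by the automaton is the subgroup generated by all states (every element of it has finitely many distinct sections). An automorphism $g$ acts level transitively if the cyclic group $\langle g\rangle$ is transitive on $X^n$ for every $n\ge0$. $C_2[[t]]$ is the ring of formal power series over the field with two elements. *)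

theory Defs
  imports
    "HOL-Library.Z2"
    "HOL-Combinatorics.Transposition"
    "HOL-Algebra.Generated_Groups"
    "HOL-Number_Theory.Cong"
    "HOL-Computational_Algebra.Polynomial_FPS"
begin

text \<open>
  The alphabet \<open>X = {0,1}\<close> is the type \<^typ>\<open>bit\<close> and \<open>X\<^sup>*\<close> is \<^typ>\<open>bit list\<close>.
  The same type \<^typ>\<open>bit\<close> also serves as the field \<open>C\<^sub>2\<close> and as the range of exponents of \<open>\<sigma>\<close>.
\<close>

subsection \<open>Automorphisms of the rooted binary tree\<close>

definition tree_adj :: "bit list \<Rightarrow> bit list \<Rightarrow> bool" where
  "tree_adj u v \<longleftrightarrow> (\<exists>x. v = u @ [x]) \<or> (\<exists>x. u = v @ [x])"

definition tree_aut :: "(bit list \<Rightarrow> bit list) \<Rightarrow> bool" where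
  "tree_aut g \<longleftrightarrow> bij g \<and> g [] = [] \<and> (\<forall>u v. tree_adj (g u) (g v) \<longleftrightarrow> tree_adj u v)"

definition Aut_tree :: "(bit list \<Rightarrow> bit list) monoid" where
  "Aut_tree = \<lparr>carrier = {g. tree_aut g}, monoid.mult = (\<circ>), one = id\<rparr>"

text \<open>Since automorphisms preserve prefixes and lengths, \<open>sect g v\<close> is the unique \<open>h\<close> with
  \<open>g (v @ w) = g v @ h w\<close> for all \<open>w\<close>; see \<open>sect_append\<close> and \<open>sect_unique\<close> below.\<close>

definition sect :: "(bit list \<Rightarrow> bit list) \<Rightarrow> bit list \<Rightarrow> bit list \<Rightarrow> bit list" where
  "sect g v = (\<lambda>w. drop (length v) (g (v @ w)))"

definition sections :: "(bit list \<Rightarrow> bit list) \<Rightarrow> (bit list \<Rightarrow> bit list) set" where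
  "sections g = range (sect g)"

definition sigma_pow :: "bit \<Rightarrow> bit \<Rightarrow> bit" where
  "sigma_pow i = (if i = 1 then Transposition.transpose 0 1 else id)"

text \<open>The element \<open>\<sigma>\<^sup>i(g\<^sub>0, g\<^sub>1)\<close>.\<close>

fun wreath :: "bit \<Rightarrow> (bit list \<Rightarrow> bit list) \<Rightarrow> (bit list \<Rightarrow> bit list) \<Rightarrow> bit list \<Rightarrow> bit list" where
  "wreath i g0 g1 [] = []"
| "wreath i g0 g1 (x # w) = sigma_pow i x # (if x = 0 then g0 w else g1 w)"

definition self_similar :: "(bit list \<Rightarrow> bit list) set \<Rightarrow> bool" where
  "self_similar G \<longleftrightarrow> (\<forall>g\<in>G. \<forall>v. sect g v \<in> G)"

definition level_transitive :: "(bit list \<Rightarrow> bit list) \<Rightarrow> bool" where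
  "level_transitive g \<longleftrightarrow>
     (\<forall>n u v. length u = n \<longrightarrow> length v = n \<longrightarrow> (\<exists>h \<in> generate Aut_tree {g}. h u = v))"

subsection \<open>Finite automata\<close>

text \<open>A state \<open>q = \<sigma>\<^bsup>act q\<^esup>(nxt q 0, nxt q 1)\<close>. Invertibility is built in, because every
  \<open>\<sigma>\<^sup>i\<close> is a permutation of \<open>X\<close>.\<close>

definition finite_automaton :: "'s set \<Rightarrow> ('s \<Rightarrow> bit) \<Rightarrow> ('s \<Rightarrow> bit \<Rightarrow> 's) \<Rightarrow> bool" where
  "finite_automaton Q act nxt \<longleftrightarrow> finite Q \<and> (\<forall>q\<in>Q. \<forall>x. nxt q x \<in> Q)"

primrec state_aut :: "('s \<Rightarrow> bit) \<Rightarrow> ('s \<Rightarrow> bit \<Rightarrow> 's) \<Rightarrow> bit list \<Rightarrow> 's \<Rightarrow> bit list" where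
  "state_aut act nxt [] q = []"
| "state_aut act nxt (x # w) q = sigma_pow (act q) x # state_aut act nxt w (nxt q x)"

definition automaton_group ::
    "'s set \<Rightarrow> ('s \<Rightarrow> bit) \<Rightarrow> ('s \<Rightarrow> bit \<Rightarrow> 's) \<Rightarrow> (bit list \<Rightarrow> bit list) set" where
  "automaton_group Q act nxt = generate Aut_tree ((\<lambda>q w. state_aut act nxt w q) ` Q)"

subsection \<open>The power series of an automorphism\<close>

definition num_active :: "(bit list \<Rightarrow> bit list) \<Rightarrow> nat \<Rightarrow> nat" where
  "num_active g i = card {v. length v = i \<and> (\<exists>x. sect g v [x] \<noteq> [x])}"

definition bar :: "(bit list \<Rightarrow> bit list) \<Rightarrow> bit fps" where
  "bar g = Abs_fps (\<lambda>i. of_nat (num_active g i mod 2))"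

subsection \<open>Well-definedness of the notions above\<close>

lemma tree_aut_child:
  assumes "tree_aut g"
  shows "\<exists>y. g (v @ [x]) = g v @ [y]"
proof (induction v arbitrary: x rule: rev_induct)
  case Nil
  have "tree_adj [] [x]" by (simp add: tree_adj_def)
  then have "tree_adj (g []) (g [x])" and "g [] = []"
    using assms unfolding tree_aut_def by blast+
  then show ?case by (auto simp: tree_adj_def)
next
  case (snoc z u)
  obtain y where y: "g (u @ [z]) = g u @ [y]" using snoc by blast
  have "tree_adj (u @ [z]) ((u @ [z]) @ [x])" by (simp add: tree_adj_def)
  then have "tree_adj (g (u @ [z])) (g ((u @ [z]) @ [x]))"
    using assms unfolding tree_aut_def by blast
  moreover have "g ((u @ [z]) @ [x]) \<noteq> g u"
    using assms by (auto simp: tree_aut_def dest: bij_is_inj injD)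
  ultimately show ?case using y unfolding tree_adj_def by auto
qed

lemma tree_aut_length [simp]:
  assumes "tree_aut g"
  shows "length (g v) = length v"
proof (induction v rule: rev_induct)
  case Nil
  then show ?case using assms by (simp add: tree_aut_def)
next
  case (snoc x v)
  then show ?case using tree_aut_child[OF assms, of v x] by auto
qed

lemma tree_aut_take:
  assumes "tree_aut g"
  shows "take (length v) (g (v @ w)) = g v"
proof (induction w rule: rev_induct)
  case Nil
  then show ?case using assms by simp
next
  case (snoc x w)
  then show ?case using tree_aut_child[OF assms, of "v @ w" x] assms by auto
qed

lemma sect_append:
  assumes "tree_aut g"
  shows "g (v @ w) = g v @ sect g v w"
  unfolding sect_def using tree_aut_take[OF assms, of v w] by (metis append_take_drop_id)

lemma sect_unique:
  assumes "tree_aut g" and "\<And>w. g (v @ w) = g v @ h w"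
  shows "h = sect g v"
  using assms sect_append by fastforce

lemma tree_autI:
  assumes "bij g" and len: "\<And>v. length (g v) = length v"
    and tk: "\<And>v w. take (length v) (g (v @ w)) = g v"
  shows "tree_aut g"
proof -
  have inj: "g u = g v \<Longrightarrow> u = v" for u v using assms(1) by (meson bij_is_inj injD)
  have child: "\<exists>y. g (v @ [x]) = g v @ [y]" for v x
  proof -
    have "g (v @ [x]) = g v @ drop (length v) (g (v @ [x]))"
      by (metis tk append_take_drop_id)
    moreover have "length (drop (length v) (g (v @ [x]))) = 1" using len by simp
    ultimately show ?thesis by (metis One_nat_def length_0_conv length_Suc_conv)
  qed
  have parent: "\<exists>x. u = v @ [x]" if "g u = g v @ [y]" for u v y
  proof -
    have "length u = Suc (length v)" using len[of u] len[of v] that by simp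
    then obtain u' x where u: "u = u' @ [x]" by (metis length_0_conv old.nat.distinct(1) rev_exhaust)
    with child[of u' x] that inj show ?thesis by auto
  qed
  have "g [] = []" using len by (metis length_0_conv)
  moreover have "tree_adj (g u) (g v) \<longleftrightarrow> tree_adj u v" for u v
    unfolding tree_adj_def using child parent by blast
  ultimately show ?thesis using assms(1) unfolding tree_aut_def by blast
qed

lemma tree_aut_comp: "tree_aut f \<Longrightarrow> tree_aut g \<Longrightarrow> tree_aut (f \<circ> g)"
  by (auto simp: tree_aut_def bij_comp)

lemma tree_aut_id: "tree_aut id"
  by (simp add: tree_aut_def)

lemma tree_aut_inv:
  assumes "tree_aut g" shows "tree_aut (inv_into UNIV g)"
  using assms unfolding tree_aut_def
  by (metis bij_imp_bij_inv bij_inv_eq_iff)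

lemma group_Aut_tree: "group Aut_tree"
proof (rule groupI)
  fix g assume "g \<in> carrier Aut_tree"
  then have "tree_aut g" by (simp add: Aut_tree_def)
  moreover from this have "inv_into UNIV g \<circ> g = id"
    by (simp add: tree_aut_def bij_is_inj)
  ultimately show "\<exists>h\<in>carrier Aut_tree. h \<otimes>\<^bsub>Aut_tree\<^esub> g = \<one>\<^bsub>Aut_tree\<^esub>"
    using tree_aut_inv by (auto simp: Aut_tree_def)
qed (auto simp: Aut_tree_def tree_aut_id tree_aut_comp comp_assoc)

lemma m_inv_Aut_tree:
  assumes "tree_aut g" shows "inv\<^bsub>Aut_tree\<^esub> g = inv_into UNIV g"
proof (rule group.inv_equality[OF group_Aut_tree])
  show "inv_into UNIV g \<otimes>\<^bsub>Aut_tree\<^esub> g = \<one>\<^bsub>Aut_tree\<^esub>"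
    using assms by (simp add: Aut_tree_def tree_aut_def bij_is_inj)
qed (use assms tree_aut_inv in \<open>auto simp: Aut_tree_def\<close>)

lemma sect_comp:
  assumes "tree_aut f" and "tree_aut g"
  shows "sect (f \<circ> g) v = sect f (g v) \<circ> sect g v"
  by (rule sect_unique[symmetric, OF tree_aut_comp[OF assms]])
     (simp add: sect_append[OF assms(1)] sect_append[OF assms(2)])

lemma tree_aut_sect:
  assumes "tree_aut g" shows "tree_aut (sect g v)"
proof (rule tree_autI)
  have inj: "g a = g b \<Longrightarrow> a = b" for a b
    using assms unfolding tree_aut_def by (meson bij_is_inj injD)
  have "inj (sect g v)"
  proof (rule injI)
    fix a b assume "sect g v a = sect g v b"
    then have "g (v @ a) = g (v @ b)" by (simp add: sect_append[OF assms])
    then show "a = b" using inj by blast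
  qed
  moreover have "\<exists>a. w = sect g v a" for w
  proof -
    obtain u where u: "g u = g v @ w"
      using assms unfolding tree_aut_def by (metis bij_pointE)
    define v' w' where "v' = take (length v) u" and "w' = drop (length v) u"
    have "length u = length v + length w"
      using tree_aut_length[OF assms, of u] tree_aut_length[OF assms, of v] u by simp
    then have len: "length v' = length v" by (simp add: v'_def)
    have "g v' @ sect g v' w' = g v @ w"
      using u sect_append[OF assms, of v' w'] by (simp add: v'_def w'_def)
    then have "g v' = g v \<and> sect g v' w' = w"
      using len tree_aut_length[OF assms] by (metis append_eq_append_conv)
    then show ?thesis using inj by blast
  qed
  ultimately show "bij (sect g v)" by (auto simp: bij_def surj_def)
  show "length (sect g v w) = length w" for w
    using assms by (simp add: sect_def)
  show "take (length a) (sect g v (a @ b)) = sect g v a" for a b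
    using tree_aut_take[OF assms, of "v @ a" b] unfolding sect_def
    by (metis append.assoc drop_take length_append add_diff_cancel_left')
qed

lemma sect_inv:
  assumes "tree_aut g"
  shows "sect (inv_into UNIV g) v = inv_into UNIV (sect g (inv_into UNIV g v))"
proof (rule sect_unique[symmetric, OF tree_aut_inv[OF assms]])
  fix w
  let ?u = "inv_into UNIV g v" and ?h = "inv_into UNIV (sect g (inv_into UNIV g v))"
  have b: "bij g" "bij (sect g ?u)"
    using assms tree_aut_sect[OF assms] by (auto simp: tree_aut_def)
  have "g (?u @ ?h w) = v @ w"
    using b by (simp add: sect_append[OF assms] bij_is_surj surj_f_inv_f)
  then show "inv_into UNIV g (v @ w) = ?u @ ?h w"
    using b(1) by (metis bij_inv_eq_iff)
qed

lemma bij_sigma_pow: "bij (sigma_pow i)"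
  by (simp add: sigma_pow_def)

lemma tree_aut_state_aut: "tree_aut (\<lambda>w. state_aut act nxt w q)"
proof (rule tree_autI)
  have inj: "state_aut act nxt a q = state_aut act nxt b q \<Longrightarrow> a = b" for a b q
  proof (induction a arbitrary: b q)
    case Nil
    then show ?case by (cases b) auto
  next
    case (Cons x a)
    then show ?case
      by (cases b) (auto dest!: injD[OF bij_is_inj[OF bij_sigma_pow]])
  qed
  have "\<exists>a. w = state_aut act nxt a q" for w q
  proof (induction w arbitrary: q)
    case Nil
    show ?case by (rule exI[of _ "[]"]) simp
  next
    case (Cons y w)
    obtain x where "y = sigma_pow (act q) x" using bij_sigma_pow by (metis bij_pointE)
    moreover obtain a where "w = state_aut act nxt a (nxt q x)" using Cons by blast
    ultimately show ?case by (intro exI[of _ "x # a"]) simp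
  qed
  then show "bij (\<lambda>w. state_aut act nxt w q)"
    using inj by (auto simp: bij_def inj_def surj_def)
  show "length (state_aut act nxt v q) = length v" for v
    by (induction v arbitrary: q) auto
  show "take (length v) (state_aut act nxt (v @ w) q) = state_aut act nxt v q" for v w
    by (induction v arbitrary: q) auto
qed

lemma state_aut_wreath:
  "(\<lambda>w. state_aut act nxt w q) =
     wreath (act q) (\<lambda>w. state_aut act nxt w (nxt q 0)) (\<lambda>w. state_aut act nxt w (nxt q 1))"
proof
  fix w show "state_aut act nxt w q =
     wreath (act q) (\<lambda>w. state_aut act nxt w (nxt q 0)) (\<lambda>w. state_aut act nxt w (nxt q 1)) w"
    by (cases w) auto
qed

lemma sect_state_aut:
  "sect (\<lambda>w. state_aut act nxt w q) v = (\<lambda>w. state_aut act nxt w (foldl nxt q v))"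
  unfolding sect_def
proof
  fix w
  show "drop (length v) (state_aut act nxt (v @ w) q) = state_aut act nxt w (foldl nxt q v)"
    by (induction v arbitrary: q) auto
qed

lemma automaton_group_sections:
  assumes aut: "finite_automaton Q act nxt" and g: "g \<in> automaton_group Q act nxt"
  shows "tree_aut g \<and> finite (sections g) \<and> sections g \<subseteq> automaton_group Q act nxt"
proof -
  let ?S = "\<lambda>q w. state_aut act nxt w q"
  have run: "foldl nxt q v \<in> Q" if "q \<in> Q" for q v
    using aut that by (induction v arbitrary: q) (auto simp: finite_automaton_def)
  have sec: "sections (?S q) \<subseteq> ?S ` Q" if "q \<in> Q" for q
    using run[OF that] by (auto simp: sections_def sect_state_aut)
  have finQ: "finite (?S ` Q)" using aut by (simp add: finite_automaton_def)
  show ?thesis using g unfolding automaton_group_def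
  proof (induction rule: generate.induct)
    case one
    have "sect id v = id" for v by (rule ext) (simp add: sect_def)
    then have s: "sections id = {id}" by (auto simp: sections_def)
    have e: "\<one>\<^bsub>Aut_tree\<^esub> = id" by (simp add: Aut_tree_def)
    have "id \<in> generate Aut_tree (?S ` Q)"
      using generate.one[of Aut_tree "?S ` Q"] unfolding e .
    then show ?case unfolding e s using tree_aut_id by blast
  next
    case (incl h)
    then obtain q where q: "q \<in> Q" "h = ?S q" by blast
    have h: "tree_aut h" unfolding q(2) by (rule tree_aut_state_aut)
    have sub: "sections h \<subseteq> ?S ` Q" unfolding q(2) by (rule sec[OF q(1)])
    then have "sections h \<subseteq> generate Aut_tree (?S ` Q)" by (blast intro: generate.incl)
    then show ?case using h finite_subset[OF sub finQ] by blast
  next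
    case (inv h)
    then obtain q where q: "q \<in> Q" "h = ?S q" by blast
    have h: "tree_aut h" unfolding q(2) by (rule tree_aut_state_aut)
    have "sections h \<subseteq> ?S ` Q" unfolding q(2) by (rule sec[OF q(1)])
    then have sub: "sections (inv_into UNIV h) \<subseteq> inv_into UNIV ` (?S ` Q)"
      unfolding sections_def sect_inv[OF h] by blast
    have "inv_into UNIV a \<in> generate Aut_tree (?S ` Q)" if a: "a \<in> ?S ` Q" for a
    proof -
      obtain q' where q': "a = ?S q'" using a by blast
      have "tree_aut a" unfolding q' by (rule tree_aut_state_aut)
      with generate.inv[OF a, of Aut_tree] show ?thesis by (simp only: m_inv_Aut_tree)
    qed
    then have "sections (inv_into UNIV h) \<subseteq> generate Aut_tree (?S ` Q)" using sub by blast
    then show ?case unfolding m_inv_Aut_tree[OF h]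
      using tree_aut_inv[OF h] finite_subset[OF sub finite_imageI[OF finQ]] by blast
  next
    case (eng f h)
    have e: "f \<otimes>\<^bsub>Aut_tree\<^esub> h = f \<circ> h" by (simp add: Aut_tree_def)
    have sub: "sections (f \<circ> h) \<subseteq> (\<lambda>(a, b). a \<circ> b) ` (sections f \<times> sections h)"
      using sect_comp[of f h] eng.IH by (fastforce simp: sections_def)
    have "a \<circ> b \<in> generate Aut_tree (?S ` Q)" if "a \<in> sections f" "b \<in> sections h" for a b
    proof -
      have "a \<otimes>\<^bsub>Aut_tree\<^esub> b \<in> generate Aut_tree (?S ` Q)"
        using that eng.IH by (blast intro: generate.eng)
      then show ?thesis by (simp add: Aut_tree_def)
    qed
    then have "sections (f \<circ> h) \<subseteq> generate Aut_tree (?S ` Q)" using sub by fastforce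
    moreover have "finite (sections (f \<circ> h))"
      using sub eng.IH by (meson finite_SigmaI finite_imageI finite_subset)
    ultimately show ?case unfolding e using tree_aut_comp eng.IH by blast
  qed
qed

corollary self_similar_automaton_group:
  "finite_automaton Q act nxt \<Longrightarrow> self_similar (automaton_group Q act nxt)"
  using automaton_group_sections by (fastforce simp: self_similar_def sections_def)

end

theory Submission
  imports Defs "HOL-Combinatorics.Cycles"
begin

text \<open>
  A vertex of level \<open>n\<close> returns to itself under \<open>g\<close> after a full tour of the level, if \<open>g\<close> is
  transitive there; the two children are swapped by then iff the number of active vertices on
  the level is odd. The coefficients of \<open>bar s\<close>, for \<open>s\<close> a section of \<open>g\<close>, satisfy the recursion
  \<open>y\<^sub>n\<^sub>+\<^sub>1(s) = y\<^sub>n(s\<^sub>0) + y\<^sub>n(s\<^sub>1)\<close>, so the vectors \<open>y\<^sub>n\<close> are iterates of a linear map on a space with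
  \<open>2\<^sup>k\<close> elements: two of \<open>y\<^sub>0, \<dots>, y\<^bsub>2^k\<^esub>\<close> coincide, and two of the \<open>2\<^sup>k\<^sup>+\<^sup>1\<close> subset sums of
  \<open>y\<^sub>0, \<dots>, y\<^sub>k\<close> coincide, which yields the period and the rational form.
\<close>

(* The simp rules of Z2 turn field operations on bits into bitwise ones,
   which breaks the ring normalisation used here. *)
declare add_bit_eq_xor [simp del] mult_bit_eq_and [simp del]

unbundle fps_syntax

section \<open>Arithmetic in the field with two elements and finiteness of levels\<close>

lemma bit_add_self: "(x::bit) + x = 0"
  by (cases x) auto

lemma of_nat_mod_2_bit: "of_nat (n mod 2) = (of_nat n :: bit)"
proof -
  have "(of_nat n :: bit) = of_nat (2 * (n div 2) + n mod 2)" by simp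
  also have "\<dots> = of_nat (n mod 2)" by (simp only: of_nat_add of_nat_mult of_nat_numeral) simp
  finally show ?thesis ..
qed

lemma UNIV_bit: "(UNIV :: bit set) = {0, 1}"
proof -
  have "x = 0 \<or> x = 1" for x :: bit by (cases x) auto
  then show ?thesis by auto
qed

lemma finite_level: "finite {v :: bit list. length v = n}"
proof -
  have "finite (UNIV :: bit set)" by (simp add: UNIV_bit)
  from finite_lists_length_eq[OF this, of n] show ?thesis by simp
qed

lemma sigma_pow_add: "sigma_pow i x = x + i"
  by (cases i; cases x) (auto simp: sigma_pow_def)

section \<open>The power series of an automorphism\<close>

text \<open>For a tree automorphism \<open>h\<close> this is the exponent of \<sigma> in its
  decomposition, read as a field element so that activities can be added.\<close>

definition root_act :: "(bit list \<Rightarrow> bit list) \<Rightarrow> bit" where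
  "root_act h = hd (h [0])"

text \<open>The two letters have distinct images, and a permutation of two letters is translation by
  the image of 0.\<close>

lemma tree_aut_singleton:
  assumes "tree_aut h"
  shows "h [x] = [x + root_act h]"
proof -
  have len: "\<exists>y. h [x] = [y]" for x
    using tree_aut_length[OF assms, of "[x]"] by (auto simp: length_Suc_conv)
  obtain a b where ab: "h [0] = [a]" "h [1] = [b]" using len by blast
  have "h [0] \<noteq> h [1]"
    using assms by (auto simp: tree_aut_def bij_def dest: injD)
  then have "b = 1 + a" using ab by (cases a; cases b) auto
  then show ?thesis using ab by (cases x) (auto simp: root_act_def)
qed

lemma tree_aut_snoc:
  assumes "tree_aut g"
  shows "g (v @ [x]) = g v @ [x + root_act (sect g v)]"
  using sect_append[OF assms] tree_aut_singleton[OF tree_aut_sect[OF assms]] by simp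

text \<open>Activities are 0 or 1, so counting active vertices modulo 2 amounts to summing
  activities in the field. Such sums are later split by first letter and reindexed along
  orbits.\<close>

lemma bar_nth:
  assumes "tree_aut g"
  shows "bar g $ n = (\<Sum>v | length v = n. root_act (sect g v))"
proof -
  have "(\<exists>x. sect g v [x] \<noteq> [x]) \<longleftrightarrow> root_act (sect g v) = 1" for v
    using tree_aut_singleton[OF tree_aut_sect[OF assms]]
    by (cases "root_act (sect g v)") auto
  then have "num_active g n = card ({v. length v = n} \<inter> {v. root_act (sect g v) = 1})"
    unfolding num_active_def by (simp add: Collect_conj_eq)
  then have "of_nat (num_active g n) = (\<Sum>v | length v = n. of_bool (root_act (sect g v) = 1) :: bit)"
    by (simp add: finite_level)
  also have "\<dots> = (\<Sum>v | length v = n. root_act (sect g v))"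
  proof (rule sum.cong)
    show "of_bool (root_act (sect g v) = 1) = root_act (sect g v)" for v
      by (cases "root_act (sect g v)") auto
  qed simp
  also have "of_nat (num_active g n) = (of_nat (num_active g n mod 2) :: bit)"
    by (rule of_nat_mod_2_bit[symmetric])
  finally show ?thesis
    by (simp add: bar_def)
qed

lemma cong_num_active_iff:
  "[num_active g i = num_active h j] (mod 2) \<longleftrightarrow> bar g $ i = bar h $ j"
  by (cases "even (num_active g i)"; cases "even (num_active h j)")
     (auto simp: bar_def cong_def even_iff_mod_2_eq_zero odd_iff_mod_2_eq_one)

lemma cong_num_active_1_iff: "[num_active g i = 1] (mod 2) \<longleftrightarrow> bar g $ i = 1"
  by (cases "even (num_active g i)")
     (auto simp: bar_def cong_def even_iff_mod_2_eq_zero odd_iff_mod_2_eq_one)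

lemma sect_sect: "sect (sect g u) v = sect g (u @ v)"
  by (auto simp: sect_def fun_eq_iff drop_drop add.commute)

lemma sect_Nil [simp]: "sect g [] = g"
  by (simp add: sect_def)

lemma sect_wreath_Cons: "sect (wreath i g0 g1) (x # v) = sect (if x = 0 then g0 else g1) v"
  by (auto simp: sect_def)

lemma level_Suc: "{v :: bit list. length v = Suc n} =
    Cons 0 ` {v. length v = n} \<union> Cons 1 ` {v. length v = n}"
proof (rule Set.set_eqI)
  fix v :: "bit list"
  show "v \<in> {v. length v = Suc n} \<longleftrightarrow>
      v \<in> Cons 0 ` {v. length v = n} \<union> Cons 1 ` {v. length v = n}"
  proof (cases v)
    case (Cons x w)
    then show ?thesis by (cases x) auto
  qed auto
qed

text \<open>The root gives the constant term. On deeper levels, the sections below 0 and 1 are those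
  of \<open>g0\<close> and \<open>g1\<close>, one level higher.\<close>

lemma bar_wreath:
  assumes g0: "tree_aut g0" and g1: "tree_aut g1" and g: "tree_aut (wreath i g0 g1)"
  shows "bar (wreath i g0 g1) = fps_const i + fps_X * (bar g0 + bar g1)"
proof (rule fps_ext)
  fix n
  show "bar (wreath i g0 g1) $ n = (fps_const i + fps_X * (bar g0 + bar g1)) $ n"
  proof (cases n)
    case 0
    then show ?thesis by (simp add: bar_nth[OF g] root_act_def sigma_pow_add)
  next
    case (Suc m)
    let ?L = "{v :: bit list. length v = m}" and ?f = "\<lambda>v. root_act (sect (wreath i g0 g1) v)"
    have "bar (wreath i g0 g1) $ n = sum ?f (Cons 0 ` ?L \<union> Cons 1 ` ?L)"
      unfolding bar_nth[OF g] Suc level_Suc ..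
    also have "\<dots> = sum ?f (Cons 0 ` ?L) + sum ?f (Cons 1 ` ?L)"
      by (rule sum.union_disjoint) (auto intro: finite_imageI[OF finite_level])
    also have "\<dots> = (\<Sum>v\<in>?L. root_act (sect g0 v)) + (\<Sum>v\<in>?L. root_act (sect g1 v))"
      by (simp add: sum.reindex sect_wreath_Cons)
    finally have "bar (wreath i g0 g1) $ n =
        (\<Sum>v\<in>?L. root_act (sect g0 v)) + (\<Sum>v\<in>?L. root_act (sect g1 v))" .
    then show ?thesis using Suc by (simp add: bar_nth[OF g0] bar_nth[OF g1])
  qed
qed

lemma tree_aut_eq_wreath:
  assumes "tree_aut g"
  shows "g = wreath (root_act g) (sect g [0]) (sect g [1])"
proof
  fix w show "g w = wreath (root_act g) (sect g [0]) (sect g [1]) w"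
  proof (cases w)
    case Nil
    then show ?thesis using assms by (simp add: tree_aut_def)
  next
    case (Cons x v)
    have "g (x # v) = g [x] @ sect g [x] v" using sect_append[OF assms, of "[x]" v] by simp
    then show ?thesis using Cons
      by (cases x) (simp_all add: tree_aut_singleton[OF assms] sigma_pow_add)
  qed
qed

lemma bar_nth_Suc:
  assumes "tree_aut g"
  shows "bar g $ Suc n = bar (sect g [0]) $ n + bar (sect g [1]) $ n"
proof -
  have "tree_aut (wreath (root_act g) (sect g [0]) (sect g [1]))"
    using assms by (simp flip: tree_aut_eq_wreath)
  from bar_wreath[OF tree_aut_sect[OF assms] tree_aut_sect[OF assms] this]
  have "bar g = fps_const (root_act g) + fps_X * (bar (sect g [0]) + bar (sect g [1]))"
    using assms by (simp flip: tree_aut_eq_wreath)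
  then show ?thesis by simp
qed

section \<open>Level transitivity\<close>

lemma tree_aut_funpow: "tree_aut g \<Longrightarrow> tree_aut (g ^^ j)"
  by (induction j) (auto simp: tree_aut_id tree_aut_comp)

text \<open>The orbit stays in a finite level, and injectivity makes it purely periodic.\<close>

lemma tree_aut_period:
  assumes "tree_aut g"
  shows "\<exists>n>0. (g ^^ n) u = u"
proof -
  have "finite {y. \<exists>n. y = (g ^^ n) u}"
    by (rule finite_subset[OF _ finite_level[of "length u"]])
       (auto simp: tree_aut_length[OF tree_aut_funpow[OF assms]])
  then show ?thesis
    using funpow_inj_finite[of g u] assms by (metis tree_aut_def bij_is_inj)
qed

text \<open>The exponent may depend on \<open>u\<close>: by periodicity, the inverse of
  \<open>g\<close> acts at \<open>u\<close> like a nonnegative power, so such powers already give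
  the orbits of the cyclic group.\<close>

lemma generate_singleton_funpow:
  assumes g: "tree_aut g" and h: "h \<in> generate Aut_tree {g}"
  shows "\<exists>j. h u = (g ^^ j) u"
  using h
proof (induction arbitrary: u rule: generate.induct)
  case one
  show ?case by (rule exI[of _ 0]) (simp add: Aut_tree_def)
next
  case (incl h)
  then show ?case by (intro exI[of _ 1]) simp
next
  case (inv h)
  then have h: "h = g" by simp
  obtain n where n: "n > 0" "(g ^^ n) u = u" using tree_aut_period[OF g] by blast
  then obtain m where "n = Suc m" using gr0_implies_Suc by blast
  then have "g ((g ^^ m) u) = u" using n by simp
  then have "inv_into UNIV g u = (g ^^ m) u"
    using g by (metis tree_aut_def bij_inv_eq_iff)
  then show ?case unfolding h m_inv_Aut_tree[OF g] by blast
next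
  case (eng f h)
  obtain j where "h u = (g ^^ j) u" using eng.IH(2) by blast
  moreover obtain i where "f (h u) = (g ^^ i) (h u)" using eng.IH(1) by blast
  ultimately show ?case
    by (intro exI[of _ "i + j"]) (simp add: Aut_tree_def funpow_add)
qed

lemma funpow_in_generate: "g ^^ j \<in> generate Aut_tree {g}"
proof (induction j)
  case 0
  show ?case using generate.one[of Aut_tree "{g}"] by (simp add: Aut_tree_def id_def)
next
  case (Suc j)
  have "g \<otimes>\<^bsub>Aut_tree\<^esub> (g ^^ j) \<in> generate Aut_tree {g}"
    by (rule generate.eng[OF generate.incl Suc]) simp
  moreover have "g \<otimes>\<^bsub>Aut_tree\<^esub> (g ^^ j) = g ^^ Suc j"
    by (simp add: Aut_tree_def)
  ultimately show ?case by metis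
qed

definition transitive_on_level :: "(bit list \<Rightarrow> bit list) \<Rightarrow> nat \<Rightarrow> bool" where
  "transitive_on_level g n \<longleftrightarrow>
     (\<forall>u v. length u = n \<longrightarrow> length v = n \<longrightarrow> (\<exists>j. (g ^^ j) u = v))"

lemma level_transitive_iff:
  assumes "tree_aut g"
  shows "level_transitive g \<longleftrightarrow> (\<forall>n. transitive_on_level g n)"
proof -
  have "(\<exists>h \<in> generate Aut_tree {g}. h u = v) \<longleftrightarrow> (\<exists>j. (g ^^ j) u = v)" for u v
    using generate_singleton_funpow[OF assms] funpow_in_generate by metis
  then show ?thesis unfolding level_transitive_def transitive_on_level_def by simp
qed

text \<open>Each application of \<open>g\<close> adds to the last letter the activity at the vertex
  currently visited.\<close>

lemma funpow_snoc:
  assumes "tree_aut g"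
  shows "(g ^^ j) (v @ [x]) = (g ^^ j) v @ [x + (\<Sum>i<j. root_act (sect g ((g ^^ i) v)))]"
  by (induction j) (simp_all add: tree_aut_snoc[OF assms] add.assoc)

text \<open>One full period of \<open>g\<close> at a vertex \<open>v\<close> of a level on which \<open>g\<close> is transitive visits every
  vertex of the level once, so its section at \<open>v\<close> has the total activity of that level.\<close>

lemma funpow_period_snoc:
  assumes g: "tree_aut g" and t: "transitive_on_level g n" and v: "length v = n"
  shows "(g ^^ least_power g v) (v @ [x]) = v @ [x + bar g $ n]"
proof -
  let ?N = "least_power g v"
  have inj: "inj (g ^^ i)" for i
    using tree_aut_funpow[OF g] by (simp add: tree_aut_def bij_is_inj)
  obtain m where "m > 0" "(g ^^ m) v = v" using tree_aut_period[OF g] by blast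
  note N = least_powerI[OF this(2,1)]
  have "inj_on (\<lambda>i. (g ^^ i) v) {..<?N}"
  proof -
    have "i = j" if "i \<le> j" "j < ?N" "(g ^^ i) v = (g ^^ j) v" for i j
    proof -
      \<comment> \<open>Cancelling \<open>g ^^ i\<close> leaves a return time \<open>j - i\<close>
        below the least positive one, hence 0.\<close>
      have "(g ^^ (i + (j - i))) v = (g ^^ i) v" using that(1,3) by simp
      then have "(g ^^ i) ((g ^^ (j - i)) v) = (g ^^ i) v"
        unfolding funpow_add comp_apply .
      then have "(g ^^ (j - i)) v = v" using inj by (meson injD)
      then have "j - i = 0" using least_power_le[of "j - i" g v] that by linarith
      then show ?thesis using that by simp
    qed
    then show ?thesis by (intro linorder_inj_onI') (metis less_irrefl_nat less_imp_le lessThan_iff)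
  qed
  moreover have "(\<lambda>i. (g ^^ i) v) ` {..<?N} = {w :: bit list. length w = n}"
  proof (intro equalityI subsetI)
    fix w :: "bit list" assume "w \<in> {w. length w = n}"
    then obtain j where "(g ^^ j) v = w" using t v unfolding transitive_on_level_def by auto
    then have "w = (g ^^ (j mod ?N)) v" using funpow_mod_eq[OF N(1)] by metis
    then show "w \<in> (\<lambda>i. (g ^^ i) v) ` {..<?N}" using N(2) by auto
  qed (auto simp: v tree_aut_length[OF tree_aut_funpow[OF g]])
  ultimately have "bij_betw (\<lambda>i. (g ^^ i) v) {..<?N} {w. length w = n}"
    unfolding bij_betw_def ..
  then have "(\<Sum>i<?N. root_act (sect g ((g ^^ i) v))) = bar g $ n"
    unfolding bar_nth[OF g] by (rule sum.reindex_bij_betw)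
  then show ?thesis using funpow_snoc[OF g, of ?N v x] N(1) by simp
qed

lemma transitive_on_level_Suc:
  assumes g: "tree_aut g"
  shows "transitive_on_level g (Suc n) \<longleftrightarrow> transitive_on_level g n \<and> bar g $ n = 1"
proof
  assume t: "transitive_on_level g (Suc n)"
  have tn: "transitive_on_level g n"
    unfolding transitive_on_level_def
  proof (intro allI impI)
    fix u v :: "bit list" assume "length u = n" "length v = n"
    then have "length (u @ [0]) = Suc n" "length (v @ [0]) = Suc n" by simp_all
    then obtain j where "(g ^^ j) (u @ [0]) = v @ [0]"
      using t unfolding transitive_on_level_def by blast
    then have "(g ^^ j) u = v" unfolding funpow_snoc[OF g] by simp
    then show "\<exists>j. (g ^^ j) u = v" ..
  qed
  define v :: "bit list" where "v = replicate n 0"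
  have v: "length v = n" by (simp add: v_def)
  then have "length (v @ [0]) = Suc n" "length (v @ [1]) = Suc n" by simp_all
  then obtain j where j: "(g ^^ j) (v @ [0]) = v @ [1]"
    using t unfolding transitive_on_level_def by blast
  then have "(g ^^ j) v = v" unfolding funpow_snoc[OF g] by simp
  \<comment> \<open>Return times of \<open>v\<close> are multiples of the least one. If one tour
    fixed \<open>v @ [0]\<close>, then \<open>g ^^ j\<close> would fix it too.\<close>
  then have "least_power g v dvd j" by (rule least_power_minimal)
  then obtain m where m: "j = least_power g v * m" by (rule dvdE)
  have "bar g $ n \<noteq> 0"
  proof
    assume "bar g $ n = 0"
    then have "(g ^^ least_power g v) (v @ [0]) = v @ [0]"
      using funpow_period_snoc[OF g tn v] by simp
    from funpow_mod_eq[OF this, of j] have "(g ^^ j) (v @ [0]) = v @ [0]"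
      using m by simp
    then show False using j by simp
  qed
  with tn show "transitive_on_level g n \<and> bar g $ n = 1" by simp
next
  assume tn: "transitive_on_level g n \<and> bar g $ n = 1"
  show "transitive_on_level g (Suc n)"
    unfolding transitive_on_level_def
  proof (intro allI impI)
    fix u' v' :: "bit list" assume "length u' = Suc n" "length v' = Suc n"
    then obtain u x v y where uv: "u' = u @ [x]" "v' = v @ [y]" "length u = n" "length v = n"
      by (metis length_Suc_conv_rev)
    then obtain j where "(g ^^ j) u = v" using tn unfolding transitive_on_level_def by blast
    then have "\<exists>z. (g ^^ j) (u @ [x]) = v @ [z]" unfolding funpow_snoc[OF g] by simp
    then obtain z where z: "(g ^^ j) (u @ [x]) = v @ [z]" ..
    \<comment> \<open>One further tour adds 1 to the last letter, so both children of
      \<open>v\<close> are reached.\<close>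
    then have "(g ^^ (least_power g v + j)) (u @ [x]) = v @ [z + 1]"
      using funpow_period_snoc[OF g, of n v z] tn uv by (simp add: funpow_add)
    moreover have "y = z \<or> y = z + 1" by (cases y; cases z) auto
    ultimately show "\<exists>j. (g ^^ j) u' = v'" using z unfolding uv(1,2) by blast
  qed
qed

lemma level_transitive_iff_bar:
  assumes "tree_aut g"
  shows "level_transitive g \<longleftrightarrow> (\<forall>n. bar g $ n = 1)"
proof -
  have "transitive_on_level g 0" by (auto simp: transitive_on_level_def intro: exI[of _ 0])
  then have "transitive_on_level g n \<longleftrightarrow> (\<forall>i<n. bar g $ i = 1)" for n
    by (induction n) (auto simp: transitive_on_level_Suc[OF assms] less_Suc_eq)
  then show ?thesis unfolding level_transitive_iff[OF assms] by blast
qed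

section \<open>Finite systems of binary linear recursions\<close>

text \<open>Multiplying \<open>f\<close> by the reversal of \<open>A\<close> turns the recurrence
  into the vanishing of all coefficients from index \<open>degree A\<close> on, so the product is a
  polynomial. The constant term of the reversal is the leading coefficient of
  \<open>A\<close>.\<close>

lemma reflect_poly_recurrence:
  fixes f :: "'a :: field fps"
  assumes "A \<noteq> 0" and rec: "\<And>n. (\<Sum>j\<le>degree A. coeff A j * f $ (j + n)) = 0"
  shows "\<exists>P R. degree P \<le> degree A \<and> degree R \<le> degree A \<and> coeff R 0 \<noteq> 0 \<and>
    f = fps_of_poly P / fps_of_poly R"
proof (intro exI conjI)
  let ?d = "degree A" and ?R = "reflect_poly A"
  let ?P = "truncate_fps ?d (f * fps_of_poly ?R)"
  show "degree ?P \<le> ?d"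
    using degree_truncate_fps[of ?d "f * fps_of_poly ?R"] by (cases "?d = 0") auto
  show "degree ?R \<le> ?d" by (rule degree_reflect_poly_le)
  show R0: "coeff ?R 0 \<noteq> 0" using assms(1) by simp
  have "(fps_of_poly ?R * f) $ (?d + n) = 0" for n
  proof -
    have "(fps_of_poly ?R * f) $ (?d + n) = (\<Sum>i=0..?d + n. coeff ?R i * f $ (?d + n - i))"
      by (simp add: fps_mult_nth)
    also have "\<dots> = (\<Sum>i\<le>?d. coeff A (?d - i) * f $ (?d + n - i))"
      by (rule sum.mono_neutral_cong_right) (auto simp: coeff_reflect_poly)
    also have "\<dots> = (\<Sum>j\<le>?d. coeff A j * f $ (j + n))"
      by (rule sum.reindex_bij_witness[of _ "\<lambda>j. ?d - j" "\<lambda>j. ?d - j"]) auto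
    finally show ?thesis using rec by simp
  qed
  then have "(f * fps_of_poly ?R) $ n = 0" if "n \<ge> ?d" for n
    using that by (metis le_add_diff_inverse mult.commute)
  then have "fps_of_poly ?P = f * fps_of_poly ?R"
    by (intro fps_ext) auto
  moreover have "fps_of_poly ?R \<noteq> 0" using R0 by force
  ultimately show "f = fps_of_poly ?P / fps_of_poly ?R" by simp
qed

text \<open>Only the coefficient recursion is kept: \<open>S\<close> will be the sections of
  \<open>g\<close>, with \<open>l\<close> and \<open>r\<close> passing to the sections at 0 and
  1.\<close>

locale bit_recursion =
  fixes S :: "'s set" and y :: "'s \<Rightarrow> bit fps" and l r :: "'s \<Rightarrow> 's"
  assumes finite_S: "finite S"
    and closed: "s \<in> S \<Longrightarrow> l s \<in> S" "s \<in> S \<Longrightarrow> r s \<in> S"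
    and nth_Suc: "s \<in> S \<Longrightarrow> y s $ Suc n = y (l s) $ n + y (r s) $ n"
begin

text \<open>A vector over the two-element field indexed by \<open>S\<close>, here a sum of
  coefficient vectors, is encoded as a subset of \<open>S\<close>, so that pigeonhole arguments
  count in \<open>Pow S\<close>.\<close>

definition support :: "nat set \<Rightarrow> 's set" where
  "support T = {s \<in> S. (\<Sum>j\<in>T. y s $ j) = 1}"

text \<open>Raising all indices by one applies the same linear map to both sums, so their equality
  persists.\<close>

lemma support_shift:
  assumes "support T = support T'" "s \<in> S"
  shows "(\<Sum>j\<in>T. y s $ (j + n)) = (\<Sum>j\<in>T'. y s $ (j + n))"
  using assms(2)
proof (induction n arbitrary: s)
  case 0
  then have "(\<Sum>j\<in>T. y s $ j) = 1 \<longleftrightarrow> (\<Sum>j\<in>T'. y s $ j) = 1"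
    using assms(1) unfolding support_def by blast
  then show ?case by (cases "\<Sum>j\<in>T. y s $ j"; cases "\<Sum>j\<in>T'. y s $ j") simp_all
next
  case (Suc n)
  have "(\<Sum>j\<in>U. y s $ (j + Suc n)) =
      (\<Sum>j\<in>U. y (l s) $ (j + n)) + (\<Sum>j\<in>U. y (r s) $ (j + n))" for U
    using nth_Suc[OF Suc.prems] by (simp add: sum.distrib)
  then show ?case using Suc.IH closed Suc.prems by simp
qed

lemma preperiodic:
  "\<exists>p m. 1 \<le> p \<and> m + p \<le> 2 ^ card S \<and> (\<forall>s\<in>S. \<forall>i\<ge>m. y s $ (i + p) = y s $ i)"
proof -
  have "(\<lambda>n. support {n}) ` {..2 ^ card S} \<subseteq> Pow S" by (auto simp: support_def)
  then have "card ((\<lambda>n. support {n}) ` {..2 ^ card S}) \<le> 2 ^ card S"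
    using card_mono finite_S by (metis card_Pow finite_Pow_iff)
  then have "\<not> inj_on (\<lambda>n. support {n}) {..2 ^ card S}"
    by (intro pigeonhole) simp
  then obtain a b where ab: "a < b" "b \<le> 2 ^ card S" "support {a} = support {b}"
    unfolding inj_on_def by (metis atMost_iff linorder_neqE_nat)
  have "y s $ (i + (b - a)) = y s $ i" if "s \<in> S" "i \<ge> a" for s i
    using support_shift[OF ab(3) that(1), of "i - a"] that(2) ab(1) by (simp add: add.commute)
  \<comment> \<open>Here \<open>m + p\<close> is \<open>b\<close>, which gives the joint
    bound.\<close>
  then show ?thesis using ab by (intro exI[of _ "b - a"] exI[of _ a]) auto
qed

lemma rational:
  assumes s: "s \<in> S"
  shows "\<exists>P R. degree P \<le> card S \<and> degree R \<le> card S \<and> coeff R 0 \<noteq> 0 \<and>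
    y s = fps_of_poly P / fps_of_poly R"
proof -
  let ?k = "card S"
  have "support ` Pow {..?k} \<subseteq> Pow S" by (auto simp: support_def)
  then have "card (support ` Pow {..?k}) \<le> 2 ^ ?k"
    using card_mono finite_S by (metis card_Pow finite_Pow_iff)
  also have "\<dots> < card (Pow {..?k})" by (simp add: card_Pow)
  finally have "\<not> inj_on support (Pow {..?k})" by (rule pigeonhole)
  then obtain T T' where T: "T \<subseteq> {..?k}" "T' \<subseteq> {..?k}" "T \<noteq> T'" "support T = support T'"
    unfolding inj_on_def by blast
  \<comment> \<open>In characteristic 2 this is the indicator of the symmetric difference of
    \<open>T\<close> and \<open>T'\<close>, nonzero because the two sets differ.\<close>
  define c where "c j = of_bool (j \<in> T) + (of_bool (j \<in> T') :: bit)" for j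
  define A where "A = (\<Sum>j\<le>?k. monom (c j) j)"
  have coeff_A: "coeff A j = c j" for j
    using T(1,2) by (auto simp: A_def coeff_sum c_def)
  have "A \<noteq> 0"
  proof -
    obtain j where "(j \<in> T) \<noteq> (j \<in> T')" using T(3) by blast
    then have "coeff A j = 1" unfolding coeff_A c_def by auto
    then show ?thesis by auto
  qed
  have deg: "degree A \<le> ?k"
    unfolding A_def by (intro degree_sum_le) (auto intro: order.trans[OF degree_monom_le])
  have "(\<Sum>j\<le>degree A. coeff A j * y s $ (j + n)) = 0" for n
  proof -
    have "(\<Sum>j\<le>degree A. coeff A j * y s $ (j + n)) = (\<Sum>j\<le>?k. c j * y s $ (j + n))"
      unfolding coeff_A[symmetric]
      by (rule sum.mono_neutral_left) (use deg in \<open>auto simp: coeff_eq_0\<close>)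
    also have "\<dots> = (\<Sum>j\<le>?k. of_bool (j \<in> T) * y s $ (j + n)) +
        (\<Sum>j\<le>?k. of_bool (j \<in> T') * y s $ (j + n))"
      by (simp add: c_def distrib_right sum.distrib)
    also have "\<dots> = (\<Sum>j\<in>T. y s $ (j + n)) + (\<Sum>j\<in>T'. y s $ (j + n))"
      by (intro arg_cong2[of _ _ _ _ "(+)"] sum.mono_neutral_cong_right) (use T(1,2) in auto)
    also have "\<dots> = 0" using support_shift[OF T(4) s] by (simp add: bit_add_self)
    finally show ?thesis .
  qed
  from reflect_poly_recurrence[OF \<open>A \<noteq> 0\<close> this] obtain P R
    where "degree P \<le> degree A" "degree R \<le> degree A" "coeff R 0 \<noteq> 0"
      "y s = fps_of_poly P / fps_of_poly R"
    by blast
  with deg show ?thesis by (intro exI[of _ P] exI[of _ R]) simp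
qed

end

section \<open>Application to the sections of a group element\<close>

lemma bit_recursion_sections:
  assumes g: "tree_aut g" and fin: "finite (sections g)"
  shows "bit_recursion (sections g) bar (\<lambda>s. sect s [0]) (\<lambda>s. sect s [1])"
proof
  show "bar s $ Suc n = bar (sect s [0]) $ n + bar (sect s [1]) $ n" if "s \<in> sections g" for s n
    using that bar_nth_Suc tree_aut_sect[OF g] by (auto simp: sections_def)
  show "finite (sections g)" by (rule fin)
qed (auto simp: sections_def sect_sect)

theorem mainTheorem7:
  fixes Q :: "'s set" and act :: "'s \<Rightarrow> bit" and nxt :: "'s \<Rightarrow> bit \<Rightarrow> 's"
    and G :: "(bit list \<Rightarrow> bit list) set" and g :: "bit list \<Rightarrow> bit list" and k :: nat
  assumes "finite_automaton Q act nxt"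
    and "G = automaton_group Q act nxt"
    and "self_similar G"
    and "g \<in> G"
    and "k = card (sections g)"
  shows "(level_transitive g \<longleftrightarrow> (\<forall>i. [num_active g i = 1] (mod 2)))
    \<and> (\<forall>i g0 g1. tree_aut g0 \<longrightarrow> tree_aut g1 \<longrightarrow> g = wreath i g0 g1 \<longrightarrow>
          bar g = fps_const i + fps_X * (bar g0 + bar g1))
    \<and> (\<exists>P R :: bit poly. degree P \<le> k \<and> degree R \<le> k \<and> coeff R 0 \<noteq> 0 \<and>
          bar g = fps_of_poly P / fps_of_poly R)
    \<and> (\<exists>p m. 1 \<le> p \<and> p \<le> 2 ^ k \<and> m \<le> 2 ^ k \<and>
          (\<forall>i\<ge>m. [num_active g (i + p) = num_active g i] (mod 2)))
    \<and> (level_transitive g \<longleftrightarrow> (\<forall>i\<le>2 ^ (k + 1). [num_active g i = 1] (mod 2)))"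
proof -
  have g: "tree_aut g" and fin: "finite (sections g)"
    using automaton_group_sections[OF assms(1)] assms(2,4) by auto
  interpret bit_recursion "sections g" bar "\<lambda>s. sect s [0]" "\<lambda>s. sect s [1]"
    by (rule bit_recursion_sections[OF g fin])
  \<comment> \<open>\<open>g\<close> is its own section at the root, so results about all sections
    apply to it.\<close>
  have gS: "g \<in> sections g" unfolding sections_def by (rule range_eqI[of _ _ "[]"]) simp
  have wr: "bar g = fps_const i + fps_X * (bar g0 + bar g1)"
    if "tree_aut g0" "tree_aut g1" "g = wreath i g0 g1" for i g0 g1
    using bar_wreath that g by blast
  obtain p m where pm: "1 \<le> p" "m + p \<le> 2 ^ k" and per: "\<And>i. i \<ge> m \<Longrightarrow> bar g $ (i + p) = bar g $ i"
    using preperiodic gS assms(5) by blast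
  \<comment> \<open>Coefficients below \<open>m + p\<close> lie in the tested range; any later one
    equals the coefficient \<open>p\<close> places earlier.\<close>
  have all: "bar g $ i = 1" if "\<forall>i\<le>2 ^ (k + 1). bar g $ i = 1" for i
  proof (induction i rule: less_induct)
    case (less i)
    show ?case
    proof (cases "i < m + p")
      case True
      then have "i \<le> 2 ^ (k + 1)" using pm(2) by simp
      then show ?thesis using that by blast
    next
      case False
      then show ?thesis using per[of "i - p"] less[of "i - p"] pm(1) by simp
    qed
  qed
  have "\<exists>p m. 1 \<le> p \<and> p \<le> 2 ^ k \<and> m \<le> 2 ^ k \<and> (\<forall>i\<ge>m. bar g $ (i + p) = bar g $ i)"
    using pm per by (intro exI[of _ p] exI[of _ m]) auto
  moreover have "\<exists>P R :: bit poly. degree P \<le> k \<and> degree R \<le> k \<and> coeff R 0 \<noteq> 0 \<and>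
      bar g = fps_of_poly P / fps_of_poly R"
    using rational[OF gS] assms(5) by simp
  ultimately show ?thesis
    unfolding cong_num_active_iff cong_num_active_1_iff level_transitive_iff_bar[OF g]
    using wr all by blast
qed

end
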